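(* Let $m$ be a positive integer. Any MAU $\alpha_1,\beta_1,\dots,\alpha_m,\beta_m$ of length $2m$ can be extended to a MAU $\alpha_1,\beta_1,\dots,\alpha_m,\beta_m,\alpha_{m+1},\beta_{m+1}$ of length $2(m+1)$. In particular, there is an infinite sequence $$\alpha_1,\ \beta_1,\ \dots,\ \alpha_m,\ \beta_m,\ \alpha_{m+1},\ \beta_{m+1},\ \dots$$ such that for any given integer $n>0$, the first $n$ terms of this sequence form a MAU of length $n$.
   Context: A sequence of complex numbers $\alpha_1,\beta_1,\dots,\alpha_m,\beta_m$ of length $2m$ is called a multiplicatively independent sequence of algebraic integers on the unit circle of length $2m$ (MAU of length $2m$) if: (i) all $\alpha_i,\beta_i$ ($1\le i\le m$) are algebraic integers; (ii) all $\alpha_i,\beta_i$ ($1\le i\le m$) have absolute value $1$; and (iii) $(\alpha_1,\beta_1,\dots,\alpha_m,\beta_m)$ is multiplicatively independent, i.e. the only integers $\ell_i,k_i$ with $\alpha_1^{\ell_1}\beta_1^{k_1}\cdots\alpha_m^{\ell_m}\beta_m^{k_m}=1$ are $\ell_i=k_i=0$ for all $i$. The subsequence $\alpha_1,\beta_1,\dots,\alpha_{m-1},\beta_{m-1},\alpha_m$ of a MAU of length $2m$ is called a MAU of length $2m-1$. *)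

theory Defs
  imports Complex_Main "HOL-Computational_Algebra.Polynomial"
begin

definition multiplicatively_independent :: "complex list \<Rightarrow> bool" where
  "multiplicatively_independent xs \<longleftrightarrow>
     (\<forall>k :: nat \<Rightarrow> int. (\<Prod>i<length xs. xs ! i powi k i) = 1 \<longrightarrow> (\<forall>i<length xs. k i = 0))"

(* The sequence \<alpha>_1, \<beta>_1, ..., \<alpha>_m, \<beta>_m is the list xs of length 2 * m, i.e.
   \<alpha>_i = xs ! (2 * i - 2) and \<beta>_i = xs ! (2 * i - 1) for 1 \<le> i \<le> m. *)
definition MAU_even :: "nat \<Rightarrow> complex list \<Rightarrow> bool" where
  "MAU_even m xs \<longleftrightarrow>
     length xs = 2 * m \<and>
     (\<forall>x\<in>set xs. algebraic_int x) \<and>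
     (\<forall>x\<in>set xs. cmod x = 1) \<and>
     multiplicatively_independent xs"

(* An MAU of odd length 2 * m - 1 is by definition an MAU of length 2 * m
   with its last term \<beta>_m removed. *)
definition MAU :: "nat \<Rightarrow> complex list \<Rightarrow> bool" where
  "MAU n xs \<longleftrightarrow>
     (\<exists>m>0. n = 2 * m \<and> MAU_even m xs) \<or>
     (\<exists>m>0. n = 2 * m - 1 \<and> (\<exists>b. MAU_even m (xs @ [b])))"

end

theory Submission
  imports Defs "HOL-Computational_Algebra.Computational_Algebra"
begin

text \<open>
  Given independent units \<open>x\<^sub>1, \<dots>, x\<^sub>l\<close>, all products of integer powers of the \<open>x\<^sub>i\<close> lie in a
  rational vector space of some finite dimension \<open>D\<close>. It therefore suffices to find an algebraic
  integer \<open>z\<close> on the unit circle none of whose powers \<open>z\<^sup>k\<close>, \<open>k > 0\<close>, has degree at most \<open>D\<close> over the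
  rationals. Take \<open>z + 1/z = a\<close> with \<open>a\<close> the positive real root of \<open>X\<^sup>n - 2\<close> and \<open>n = 4(D + 1)\<close>.
  As \<open>z\<close> is not real and \<open>X\<^sup>n - 2\<close> is irreducible, every solution \<open>w\<close> of \<open>w + 1/w = b\<close> with \<open>b\<^sup>n = 2\<close>
  is a conjugate of \<open>z\<close>. The level sets of \<open>\<bar>w\<bar>\<close> in the \<open>b\<close>-plane are ellipses with foci \<open>\<plusminus>2\<close>, and each
  meets the circle \<open>\<bar>b\<bar> = a\<close> in at most four points, so more than \<open>D\<close> different values \<open>\<bar>w\<bar>\<close>
  occur. Hence \<open>z\<^sup>k\<close> has more than \<open>D\<close> conjugates for every \<open>k > 0\<close>.
\<close>

section \<open>Rational polynomials evaluated at complex numbers\<close>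

abbreviation rpoly :: "rat poly \<Rightarrow> complex \<Rightarrow> complex" where
  "rpoly p x \<equiv> poly (map_poly of_rat p) x"

lemma map_poly_of_rat_add:
  "map_poly of_rat (p + q) = (map_poly of_rat p + map_poly of_rat q :: 'a::field_char_0 poly)"
  by (rule poly_eqI) (simp add: coeff_map_poly of_rat_add)

lemma map_poly_of_rat_mult:
  "map_poly of_rat (p * q) = (map_poly of_rat p * map_poly of_rat q :: 'a::field_char_0 poly)"
  by (rule poly_eqI) (simp add: coeff_map_poly coeff_mult of_rat_mult of_rat_sum)

lemma map_poly_of_rat_minus:
  "map_poly of_rat (- p) = (- map_poly of_rat p :: 'a::field_char_0 poly)"
  by (rule poly_eqI) (simp add: coeff_map_poly of_rat_minus)

lemma rpoly_simps [simp]: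
  "rpoly 0 x = 0" "rpoly (pCons c p) x = of_rat c + x * rpoly p x"
  "rpoly (- p) x = - rpoly p x"
  "rpoly (p + q) x = rpoly p x + rpoly q x" "rpoly (p * q) x = rpoly p x * rpoly q x"
  "rpoly (monom c k) x = of_rat c * x ^ k"
  by (simp_all add: map_poly_pCons map_poly_of_rat_minus map_poly_of_rat_add
      map_poly_of_rat_mult map_poly_monom poly_monom)

lemma rpoly_cnj: "cnj (rpoly p x) = rpoly p (cnj x)"
proof (induction p)
  case (pCons c p)
  have "cnj (of_rat c) = of_rat c"
    by (cases c) (simp add: of_rat_rat)
  then show ?case using pCons by simp
qed simp

subsection \<open>Conjugates of radicals of two\<close>

text \<open>Compare the exponent of 2 on both sides of \<open>u ^ n = 2 ^ m * v ^ n\<close>, where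
  \<open>c\<close> is the fraction \<open>u / v\<close>: the two \<open>n\<close>-th powers
  contribute multiples of \<open>n\<close>.\<close>

lemma rat_power_eq_two_power:
  fixes c :: rat
  assumes "c ^ n = 2 ^ m"
  shows "n dvd m"
proof (cases c)
  case (Fract u v)
  have v: "v \<noteq> 0" using Fract by simp
  have "(of_int u / of_int v :: rat) ^ n = 2 ^ m"
    using assms Fract by (simp add: Fract_of_int_quotient)
  then have "(of_int (u ^ n) :: rat) = of_int (2 ^ m * v ^ n)"
    using v by (simp add: power_divide field_simps)
  then have eq: "u ^ n = 2 ^ m * v ^ n" by (simp only: of_int_eq_iff)
  then have u: "u \<noteq> 0 \<or> n = 0" using v
    by (metis mult_eq_0_iff power_eq_0_iff power_zero_numeral zero_neq_numeral not_gr_zero)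
  have p: "prime_elem (2::int)" by simp
  show ?thesis
  proof (cases "n = 0")
    case True
    then show ?thesis using eq by (cases m) (auto simp: zmult_eq_1_iff)
  next
    case False
    with u have "u \<noteq> 0" by simp
    have "n * multiplicity 2 u = multiplicity 2 (2 ^ m * v ^ n)"
      using eq \<open>u \<noteq> 0\<close> p by (metis prime_elem_multiplicity_power_distrib)
    also have "\<dots> = m + n * multiplicity 2 v"
      using p v by (simp add: prime_elem_multiplicity_mult_distrib prime_elem_multiplicity_power_distrib)
    finally show ?thesis by (metis dvd_add_left_iff dvd_triv_left)
  qed
qed

text \<open>Over the complex numbers \<open>p\<close> splits into linear factors, so its value at 0
  is the leading coefficient times the product of the negated roots.\<close>

lemma norm_poly_0_of_equal_norm_roots:
  fixes p :: "complex poly"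
  assumes "\<And>z. poly p z = 0 \<Longrightarrow> norm z = r"
  shows "norm (poly p 0) = norm (lead_coeff p) * r ^ degree p"
proof (cases "p = 0")
  case False
  obtain root where root: "smult (lead_coeff p) (\<Prod>i<degree p. [:-root i, 1:]) = p"
    by (rule complex_poly_decompose')
  have poly: "poly p z = lead_coeff p * (\<Prod>i<degree p. z - root i)" for z
    by (subst root [symmetric]) (simp add: poly_prod)
  have "norm (root i) = r" if "i < degree p" for i
  proof (rule assms)
    show "poly p (root i) = 0" unfolding poly using that by (auto intro!: prod_zero)
  qed
  then have "norm (\<Prod>i<degree p. 0 - root i) = r ^ degree p"
    by (simp flip: prod_norm)
  then show ?thesis unfolding poly by (simp add: norm_mult)
qed simp

text \<open>
  All roots of \<open>X\<^sup>n - 2\<close> have the same absolute value, so a rational factor of degree \<open>m\<close> has, up to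
  sign, constant coefficient \<open>2\<^bsup>m/n\<^esup>\<close> relative to its leading one, which forces \<open>n\<close> to divide \<open>m\<close>.
\<close>
lemma rpoly_conjugate_root:
  fixes p :: "rat poly" and a b :: complex
  assumes n: "n > 0" and a: "a ^ n = 2" and b: "b ^ n = 2" and pa: "rpoly p a = 0"
  shows "rpoly p b = 0"
proof -
  define f :: "rat poly" where "f = monom 1 n + [:-2:]"
  have f_root: "rpoly f x = 0 \<longleftrightarrow> x ^ n = 2" for x
    by (simp add: f_def)
  have degf: "degree f = n"
    unfolding f_def using n by (subst degree_add_eq_left) (auto simp: degree_monom_eq)
  have f0: "f \<noteq> 0" using degf n by auto
  define P where "P = (\<lambda>q :: rat poly. q \<noteq> 0 \<and> rpoly q a = 0)"
  \<comment> \<open>Up to a scalar, \<open>g\<close> is the minimal polynomial of \<open>a\<close>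
    over the rationals; division with remainder shows that it divides every rational polynomial
    vanishing at \<open>a\<close>.\<close>
  define g where "g = (ARG_MIN degree q. P q)"
  have "P f" using f0 a f_root by (simp add: P_def)
  then have Pg: "P g" and min: "\<And>q. P q \<Longrightarrow> degree g \<le> degree q"
    unfolding g_def by (auto intro: arg_min_natI arg_min_nat_le)
  have g_dvd: "g dvd q" if "rpoly q a = 0" for q
  proof (rule ccontr)
    assume nd: "\<not> g dvd q"
    have "rpoly q a = rpoly (q div g * g + q mod g) a" by simp
    also have "\<dots> = rpoly (q mod g) a" using Pg unfolding rpoly_simps P_def by simp
    finally have "P (q mod g)" using that nd by (simp add: P_def dvd_eq_mod_eq_0)
    then have "degree g \<le> degree (q mod g)" by (rule min)
    moreover have "degree (q mod g) < degree g"
      using Pg nd degree_mod_less[of g q] by (auto simp: P_def dvd_eq_mod_eq_0)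
    ultimately show False by simp
  qed
  obtain h where h: "f = g * h" using g_dvd[of f] a f_root by (auto elim: dvdE)
  define G :: "complex poly" where "G = map_poly of_rat g"
  define r where "r = root n 2"
  have r: "r > 0" "r ^ n = 2" using n by (simp_all add: r_def)
  have "norm x = r" if "poly G x = 0" for x
  proof -
    have "x ^ n = 2" using f_root[of x] that h by (simp add: G_def)
    then have "norm x ^ n = r ^ n" using r by (metis norm_numeral norm_power)
    then show ?thesis by (rule power_eq_imp_eq_base) (use r n in auto)
  qed
  then have "norm (poly G 0) = norm (lead_coeff G) * r ^ degree G"
    by (rule norm_poly_0_of_equal_norm_roots)
  then have *: "norm (of_rat (coeff g 0) :: complex) = norm (of_rat (lead_coeff g) :: complex) * r ^ degree g"
    by (simp add: G_def poly_0_coeff_0 coeff_map_poly degree_map_poly)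
  define c where "c = coeff g 0 / lead_coeff g"
  have lc: "lead_coeff g \<noteq> 0" using Pg by (simp add: P_def)
  have "norm (of_rat c :: complex) = r ^ degree g"
    using * lc by (simp add: c_def of_rat_divide norm_divide)
  moreover have "norm (of_rat c :: complex) = of_rat \<bar>c\<bar>"
  proof -
    have "(of_rat c :: complex) = of_real (of_rat c)"
      by (cases c) (simp add: of_rat_rat)
    then show ?thesis by (simp add: abs_rat_def of_rat_minus abs_if)
  qed
  ultimately have "(of_rat \<bar>c\<bar> :: real) ^ n = (r ^ degree g) ^ n" by simp
  also have "\<dots> = of_rat (2 ^ degree g)"
    using r by (simp add: of_rat_power mult.commute flip: power_mult) (simp add: power_mult)
  finally have "\<bar>c\<bar> ^ n = 2 ^ degree g" by (simp flip: of_rat_power)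
  then have "n dvd degree g" by (rule rat_power_eq_two_power)
  moreover have "degree g > 0"
  proof (rule ccontr)
    assume "\<not> degree g > 0"
    then obtain d where "g = [:d:]" by (auto elim: degree_eq_zeroE)
    then show False using Pg by (simp add: P_def)
  qed
  ultimately have "degree g \<ge> n" by (auto intro: dvd_imp_le)
  \<comment> \<open>Since \<open>degree g \<ge> n = degree f\<close>, the cofactor \<open>h\<close>
    is a nonzero constant, so every root of \<open>f\<close>, in particular \<open>b\<close>, is a
    root of \<open>g\<close>.\<close>
  moreover have "degree f = degree g + degree h" using h f0 by (auto simp: degree_mult_eq)
  ultimately have "degree h = 0" using degf by simp
  then obtain e where e: "h = [:e:]" by (auto elim: degree_eq_zeroE)
  have "e \<noteq> 0" using e h f0 by auto
  have "rpoly g b * of_rat e = 0"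
    using f_root[of b] b unfolding h e by (simp only: rpoly_simps) simp
  then have "rpoly g b = 0" using \<open>e \<noteq> 0\<close> by simp
  moreover obtain k where "p = g * k" using g_dvd[OF pa] by (auto elim: dvdE)
  ultimately show ?thesis by simp
qed

subsection \<open>A unit whose powers have large degree\<close>

text \<open>Repeatedly replacing \<open>z * z\<close> by \<open>a * z - 1\<close> leaves a linear
  expression in \<open>z\<close>. The pair \<open>A\<close>, \<open>B\<close> depends on
  \<open>Q\<close> alone, so the same pair serves \<open>a\<close> and all its conjugates.\<close>

lemma rpoly_reduce_quadratic:
  "\<exists>A B. \<forall>a z. z\<^sup>2 + 1 = a * z \<longrightarrow> rpoly Q z = rpoly A a * z + rpoly B a"
proof (induction Q)
  case 0
  show ?case by (rule exI[of _ 0], rule exI[of _ 0]) simp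
next
  case (pCons c Q)
  then obtain A B where AB: "\<And>a z. z\<^sup>2 + 1 = a * z \<Longrightarrow> rpoly Q z = rpoly A a * z + rpoly B a"
    by blast
  have "rpoly (pCons c Q) z = rpoly (pCons 0 A + B) a * z + rpoly ([:c:] + - A) a"
    if "z\<^sup>2 + 1 = a * z" for a z
  proof -
    have z2: "z * z = a * z - 1" using that by (simp add: power2_eq_square algebra_simps eq_diff_eq)
    have "z * (rpoly A a * z) = rpoly A a * (z * z)" by simp
    also have "\<dots> = rpoly A a * (a * z - 1)" by (simp only: z2)
    finally show ?thesis unfolding rpoly_simps AB[OF that]
      by (simp add: algebra_simps)
  qed
  then show ?case by blast
qed

text \<open>For real \<open>a\<close> and non-real \<open>z\<close>, the relation
  \<open>A(a) * z + B(a) = 0\<close> forces \<open>A(a) = B(a) = 0\<close>. Both equations pass to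
  the conjugate \<open>b\<close> of \<open>a\<close>, and the reduction read backwards gives
  \<open>Q(w) = 0\<close>.\<close>

lemma rpoly_joukowski_conjugate:
  assumes n: "n > 0" and a: "a ^ n = 2" "a \<in> \<real>" and b: "b ^ n = 2"
    and z: "z\<^sup>2 + 1 = a * z" "z \<notin> \<real>" and w: "w\<^sup>2 + 1 = b * w"
    and Q: "rpoly Q z = 0"
  shows "rpoly Q w = 0"
proof -
  obtain A B where AB: "\<And>a z. z\<^sup>2 + 1 = a * z \<Longrightarrow> rpoly Q z = rpoly A a * z + rpoly B a"
    using rpoly_reduce_quadratic by blast
  have "cnj a = a" using a by (simp add: Reals_cnj_iff)
  then have real: "rpoly p a \<in> \<real>" for p by (simp add: Reals_cnj_iff rpoly_cnj)
  have 0: "rpoly A a * z + rpoly B a = 0" using AB[OF z(1)] Q by simp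
  have "rpoly A a = 0"
  proof (rule ccontr)
    assume "rpoly A a \<noteq> 0"
    then have "z = - rpoly B a / rpoly A a" using 0 by (simp add: field_simps eq_neg_iff_add_eq_0)
    then show False using z(2) real by (metis Reals_divide Reals_minus)
  qed
  then have "rpoly A b = 0" "rpoly B b = 0"
    using 0 rpoly_conjugate_root[OF n a(1) b] by auto
  then show ?thesis using AB[OF w] by simp
qed

text \<open>The absolute value of \<open>z\<close> fixes the sum of the distances from
  \<open>a\<close> to the foci 2 and -2. Squaring that sum, with \<open>norm a\<close> known,
  isolates \<open>norm (a\<^sup>2 - 4)\<close>, which in turn yields
  \<open>Re (a\<^sup>2)\<close>.\<close>

lemma joukowski_norm_determines:
  assumes z: "z\<^sup>2 + 1 = a * z" and w: "w\<^sup>2 + 1 = b * w"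
    and nz: "norm z = norm w" and na: "norm a = norm b"
  shows "Re (a\<^sup>2) = Re (b\<^sup>2)"
proof -
  have par: "norm (x - 2) ^ 2 + norm (x + 2) ^ 2 = 2 * norm x ^ 2 + 8" for x :: complex
    by (simp only: cmod_power2) (simp add: power2_eq_square algebra_simps)
  have sq: "norm (x\<^sup>2 - 4) ^ 2 = norm x ^ 4 + 16 - 8 * Re (x\<^sup>2)" for x :: complex
  proof -
    have "norm x ^ 4 = ((Re x)\<^sup>2 + (Im x)\<^sup>2)\<^sup>2"
      by (simp flip: cmod_power2)
    then show ?thesis
      by (simp only: cmod_power2) (simp add: power2_eq_square algebra_simps)
  qed
  \<comment> \<open>The equation for \<open>x\<close> makes \<open>(x - 1)\<^sup>2\<close> and
    \<open>(x + 1)\<^sup>2\<close> equal to \<open>x\<close> times \<open>c - 2\<close> and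
    \<open>c + 2\<close>; add their absolute values and apply the parallelogram law.\<close>
  have key: "2 * (norm x ^ 2 + 1) = norm x * (norm (c - 2) + norm (c + 2))"
    if "x\<^sup>2 + 1 = c * x" for x c :: complex
  proof -
    have "norm (x - 1) ^ 2 = norm ((x - 1)\<^sup>2)" by (simp add: norm_power)
    also have "(x - 1)\<^sup>2 = x * (c - 2)" using that by (simp add: power2_eq_square algebra_simps)
    finally have 1: "norm (x - 1) ^ 2 = norm x * norm (c - 2)" by (simp add: norm_mult)
    have "norm (x + 1) ^ 2 = norm ((x + 1)\<^sup>2)" by (simp add: norm_power)
    also have "(x + 1)\<^sup>2 = x * (c + 2)" using that by (simp add: power2_eq_square algebra_simps)
    finally have 2: "norm (x + 1) ^ 2 = norm x * norm (c + 2)" by (simp add: norm_mult)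
    have "norm (x - 1) ^ 2 + norm (x + 1) ^ 2 = 2 * (norm x ^ 2 + 1)"
      by (simp only: cmod_power2) (simp add: power2_eq_square algebra_simps)
    then show ?thesis using 1 2 by (simp add: algebra_simps)
  qed
  have "norm z \<noteq> 0" using z by auto
  then have s: "norm (a - 2) + norm (a + 2) = norm (b - 2) + norm (b + 2)"
    using key[OF z] key[OF w] nz by simp
  have id: "(norm (x - 2) + norm (x + 2)) ^ 2 = 2 * norm x ^ 2 + 8 + 2 * norm (x\<^sup>2 - 4)" for x :: complex
  proof -
    have "norm (x\<^sup>2 - 4) = norm (x - 2) * norm (x + 2)"
      by (simp add: power2_eq_square algebra_simps flip: norm_mult)
    then show ?thesis using par[of x] by (simp add: power2_sum)
  qed
  have "norm (a\<^sup>2 - 4) = norm (b\<^sup>2 - 4)" using id[of a] id[of b] s na by simp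
  then show ?thesis using sq[of a] sq[of b] na by simp
qed

lemma exists_joukowski_preimage: "\<exists>z :: complex. z\<^sup>2 + 1 = a * z"
proof
  show "((a + csqrt (a\<^sup>2 - 4)) / 2)\<^sup>2 + 1 = a * ((a + csqrt (a\<^sup>2 - 4)) / 2)"
  proof -
    have "csqrt (a\<^sup>2 - 4) * csqrt (a\<^sup>2 - 4) = a\<^sup>2 - 4" by (simp flip: power2_eq_square)
    then show ?thesis by (simp add: power2_eq_square field_simps) algebra
  qed
qed

lemma exists_unit_no_power_of_small_degree:
  "\<exists>z. algebraic_int z \<and> norm z = 1 \<and>
     (\<forall>k>0. \<forall>P. P \<noteq> 0 \<longrightarrow> degree P \<le> D \<longrightarrow> rpoly P (z ^ k) \<noteq> 0)"
proof -
  define n where "n = 4 * (D + 1)"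
  have n: "n > 0" by (simp add: n_def)
  define r where "r = root n 2"
  have r: "r > 0" "r ^ n = 2" using n by (simp_all add: r_def)
  have r2: "r < 2"
  proof (rule ccontr)
    assume "\<not> r < 2"
    then have "2 ^ n \<le> r ^ n" by (intro power_mono) auto
    moreover have "(2::real) ^ 1 < 2 ^ n" by (rule power_strict_increasing) (auto simp: n_def)
    ultimately show False using r by simp
  qed
  then have r4: "r\<^sup>2 < 4" using r power_strict_mono[of r 2 2] by simp
  \<comment> \<open>The root of \<open>X^2 - r * X + 1\<close> in the upper half plane. As
    \<open>r < 2\<close>, the two roots are non-real complex conjugates with product 1, hence of
    absolute value 1.\<close>
  define z where "z = Complex (r / 2) (sqrt (1 - r\<^sup>2 / 4))"
  have im: "sqrt (1 - r\<^sup>2 / 4) > 0" "(sqrt (1 - r\<^sup>2 / 4))\<^sup>2 = 1 - r\<^sup>2 / 4" using r4 by simp_all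
  have z_nonreal: "z \<notin> \<real>" using im by (auto simp: z_def complex_is_Real_iff)
  have z_norm: "norm z = 1" using im by (simp add: z_def cmod_def power_divide)
  have z_eq: "z\<^sup>2 + 1 = of_real r * z"
    using im(2) by (simp add: z_def complex_eq_iff power2_eq_square field_simps)
  have z_int: "algebraic_int z"
  proof -
    \<comment> \<open>Raising \<open>z\<^sup>2 + 1 = r * z\<close> to the \<open>n\<close>-th power
      removes the radical: \<open>q\<close> is \<open>(X^2 + 1)^n - 2 * X^n\<close>, monic with
      integer coefficients.\<close>
    define q :: "complex poly" where "q = [:1, 0, 1:] ^ n + monom (-2) n"
    have deg: "degree ([:1, 0, 1:] ^ n :: complex poly) = 2 * n" by (simp add: degree_power_eq)
    have "degree (monom (-2) n :: complex poly) < degree ([:1, 0, 1:] ^ n :: complex poly)"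
      using n deg by (simp add: degree_monom_eq)
    then have "lead_coeff q = lead_coeff ([:1, 0, 1:] ^ n)"
      unfolding q_def by (subst (1 2) add.commute) (rule lead_coeff_add_le)
    then have "lead_coeff q = 1" by (simp add: lead_coeff_power)
    moreover have "coeff ([:1, 0, 1:] ^ m) i \<in> (\<int> :: complex set)" for m i
    proof (induction m arbitrary: i)
      case (Suc m)
      then show ?case
        by (auto simp: coeff_pCons split: nat.split)
    qed (simp add: coeff_1)
    then have "coeff q i \<in> \<int>" for i by (simp add: q_def)
    moreover have "poly q z = 0"
    proof -
      have "(1 + z * z) ^ n = 2 * z ^ n"
        using z_eq r by (simp add: add.commute power2_eq_square power_mult_distrib flip: of_real_power)
      then show ?thesis by (simp add: q_def poly_monom)
    qed
    ultimately show ?thesis by (blast intro: algebraic_int.intros)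
  qed
  \<comment> \<open>The angle is \<open>2 * pi * j / n\<close>, so each \<open>b j\<close> is an
    \<open>n\<close>-th root of 2. For \<open>j \<le> D\<close> the doubled angle, which governs
    \<open>Re ((b j)\<^sup>2)\<close>, stays in the interval from 0 to \<open>pi\<close>, where
    cosine is injective.\<close>
  define b where "b j = of_real r * cis (pi * real j / real (D + 1) / 2)" for j :: nat
  have bn: "b j ^ n = 2" for j
  proof -
    have "real n * (pi * real j / real (D + 1) / 2) = 2 * pi * real j"
    proof -
      define d where "d = real (D + 1)"
      have "real n = 4 * d" "d \<noteq> 0" by (simp_all add: n_def d_def)
      then show ?thesis unfolding d_def[symmetric] by (simp add: field_simps)
    qed
    then have "cis (pi * real j / real (D + 1) / 2) ^ n = cis (2 * pi * real j)"
      by (simp only: DeMoivre)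
    also have "\<dots> = 1" by (simp add: cis_multiple_2pi)
    finally show ?thesis using r unfolding b_def power_mult_distrib
      by (metis mult_cancel_left1 mult.commute mult_1_left of_real_numeral of_real_power)
  qed
  have "\<forall>j. \<exists>w. w\<^sup>2 + 1 = b j * w" using exists_joukowski_preimage by blast
  then obtain w where w: "\<And>j. (w j)\<^sup>2 + 1 = b j * w j" by metis
  have b_re: "Re ((b j)\<^sup>2) = r\<^sup>2 * cos (pi * real j / real (D + 1))" for j
  proof -
    have half: "real 2 * (x / 2) = x" for x by simp
    have "(b j)\<^sup>2 = of_real (r\<^sup>2) * cis (real 2 * (pi * real j / real (D + 1) / 2))"
      by (simp only: b_def power_mult_distrib DeMoivre of_real_power)
    also have "real 2 * (pi * real j / real (D + 1) / 2) = pi * real j / real (D + 1)"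
      by (rule half)
    finally show ?thesis by simp
  qed
  have inj: "inj_on (\<lambda>j. norm (w j)) {..D}"
  proof (rule inj_onI)
    fix i j assume ij: "i \<in> {..D}" "j \<in> {..D}" and eq: "norm (w i) = norm (w j)"
    have "Re ((b i)\<^sup>2) = Re ((b j)\<^sup>2)"
      by (rule joukowski_norm_determines[OF w w eq]) (simp add: b_def norm_mult)
    then have "cos (pi * real i / real (D + 1)) = cos (pi * real j / real (D + 1))"
      using r by (simp add: b_re)
    moreover have "0 \<le> pi * real l / real (D + 1) \<and> pi * real l / real (D + 1) \<le> pi"
      if "l \<in> {..D}" for l
    proof
      have "pi * real l \<le> pi * real (D + 1)" using that by (intro mult_left_mono) auto
      then show "pi * real l / real (D + 1) \<le> pi" by (simp only: pos_divide_le_eq of_nat_0_less_iff)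
    qed simp
    ultimately have "pi * real i / real (D + 1) = pi * real j / real (D + 1)"
      using ij cos_inj_pi by blast
    then show "i = j" by simp
  qed
  have "rpoly P (z ^ k) \<noteq> 0" if k: "k > 0" and P: "P \<noteq> 0" "degree P \<le> D" for k P
  proof
    assume 0: "rpoly P (z ^ k) = 0"
    \<comment> \<open>\<open>Q\<close> is \<open>P(X^k)\<close>. It vanishes at \<open>z\<close>,
      hence at every \<open>w j\<close>, which gives \<open>P\<close> the \<open>D + 1\<close>
      distinct roots \<open>w j ^ k\<close> with \<open>j \<le> D\<close>.\<close>
    define Q where "Q = pcompose P (monom 1 k)"
    have Q: "rpoly Q x = rpoly P (x ^ k)" for x
      unfolding Q_def by (induction P) (simp_all add: pcompose_pCons)
    have "rpoly P (w j ^ k) = 0" for j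
      unfolding Q[symmetric]
      by (rule rpoly_joukowski_conjugate[OF n _ _ bn z_eq z_nonreal w])
        (use r 0 Q in \<open>simp_all flip: of_real_power\<close>)
    then have sub: "(\<lambda>j. w j ^ k) ` {..D} \<subseteq> {x. rpoly P x = 0}" by auto
    have inj_k: "inj_on (\<lambda>j. w j ^ k) {..D}"
    proof (rule inj_onI)
      fix i j assume ij: "i \<in> {..D}" "j \<in> {..D}" and "w i ^ k = w j ^ k"
      then have "norm (w i) ^ k = norm (w j) ^ k" by (metis norm_power)
      then have "norm (w i) = norm (w j)" using k by (simp add: power_eq_iff_eq_base)
      then show "i = j" using inj ij by (simp add: inj_on_def)
    qed
    have P': "(map_poly of_rat P :: complex poly) \<noteq> 0" using P by (simp add: map_poly_eq_0_iff)
    have "D + 1 = card ((\<lambda>j. w j ^ k) ` {..D})" using inj_k by (simp add: card_image)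
    also have "\<dots> \<le> card {x. rpoly P x = 0}"
      by (rule card_mono[OF poly_roots_finite[OF P'] sub])
    also have "\<dots> \<le> degree (map_poly of_rat P :: complex poly)"
      by (rule card_poly_roots_bound[OF P'])
    also have "\<dots> = degree P" by (simp add: degree_map_poly)
    finally show False using P by simp
  qed
  then show ?thesis using z_int z_norm by blast
qed

subsection \<open>Rational spans of groups of units\<close>

interpretation rat_vs: vector_space "\<lambda>(q::rat) (x::complex). of_rat q * x"
  by unfold_locales (simp_all add: algebra_simps of_rat_add of_rat_mult)

text \<open>Multiplication is bilinear over the rationals. For finite \<open>A\<close> and
  \<open>B\<close> the new spanning set is again finite.\<close>

lemma rat_span_mult:
  assumes "x \<in> rat_vs.span A" "y \<in> rat_vs.span B"
  shows "x * y \<in> rat_vs.span ((\<lambda>(u, v). u * v) ` (A \<times> B))"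
    (is "_ \<in> rat_vs.span ?C")
  using assms(1)
proof (induction rule: rat_vs.span_induct_alt)
  case base
  show ?case by (simp add: rat_vs.span_zero)
next
  case (step c u x)
  have "u * y \<in> rat_vs.span ?C"
    using assms(2)
  proof (induction rule: rat_vs.span_induct_alt)
    case base
    show ?case by (simp add: rat_vs.span_zero)
  next
    case (step d v y)
    have "u * v \<in> ?C" using \<open>u \<in> A\<close> step.hyps by force
    then have "of_rat d * (u * v) + u * y \<in> rat_vs.span ?C"
      by (rule rat_vs.span_add[OF rat_vs.span_scale[OF rat_vs.span_base] step.IH])
    then show ?case by (simp add: algebra_simps)
  qed
  then have "of_rat c * (u * y) + x * y \<in> rat_vs.span ?C"
    using step.IH by (intro rat_vs.span_add rat_vs.span_scale)
  then show ?case by (simp add: algebra_simps)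
qed

text \<open>A monic integer equation of degree \<open>d\<close> expresses \<open>x ^ d\<close>
  through lower powers, so the powers below \<open>d\<close> span all the others.\<close>

lemma algebraic_int_powers_rat_span:
  assumes "algebraic_int (x :: complex)"
  shows "\<exists>S. finite S \<and> (\<forall>k. x ^ k \<in> rat_vs.span S)"
proof -
  obtain p :: "complex poly" where p: "lead_coeff p = 1" "\<And>i. coeff p i \<in> \<int>" "poly p x = 0"
    using assms by (auto elim: algebraic_int.cases)
  define d where "d = degree p"
  have xd: "x ^ d = - (\<Sum>i<d. coeff p i * x ^ i)"
    using p(1,3) unfolding poly_altdef d_def lessThan_Suc_atMost[symmetric]
    by (simp add: add_eq_0_iff)
  have "x ^ k \<in> rat_vs.span ((\<lambda>i. x ^ i) ` {..<d})" for k
  proof (induction k rule: less_induct)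
    case (less k)
    show ?case
    proof (cases "k < d")
      case True
      then show ?thesis by (auto intro: rat_vs.span_base)
    next
      case False
      then have "x ^ k = x ^ (k - d) * x ^ d" by (simp flip: power_add)
      also have "\<dots> = - (\<Sum>i<d. coeff p i * x ^ (k - d + i))"
        by (simp add: xd sum_distrib_left power_add mult_ac)
      also have "\<dots> \<in> rat_vs.span ((\<lambda>i. x ^ i) ` {..<d})"
      proof (intro rat_vs.span_neg rat_vs.span_sum)
        fix i assume "i \<in> {..<d}"
        then have "x ^ (k - d + i) \<in> rat_vs.span ((\<lambda>i. x ^ i) ` {..<d})"
          using False by (intro less) auto
        moreover obtain c where "coeff p i = of_int c" using p(2) by (auto elim: Ints_cases)
        ultimately show "coeff p i * x ^ (k - d + i) \<in> rat_vs.span ((\<lambda>i. x ^ i) ` {..<d})"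
          using rat_vs.span_scale[of _ _ "of_int c"] by simp
      qed
      finally show ?thesis .
    qed
  qed
  then show ?thesis by (intro exI[of _ "(\<lambda>i. x ^ i) ` {..<d}"]) simp
qed

text \<open>On the unit circle the inverse of \<open>x\<close> is \<open>cnj x\<close>, again an
  algebraic integer, which takes care of the negative exponents.\<close>

lemma unit_algebraic_int_powi_rat_span:
  assumes "algebraic_int (x :: complex)" "norm x = 1"
  shows "\<exists>S. finite S \<and> (\<forall>k. x powi k \<in> rat_vs.span S)"
proof -
  obtain S T where S: "finite S" "\<And>k. x ^ k \<in> rat_vs.span S"
    and T: "finite T" "\<And>k. (cnj x) ^ k \<in> rat_vs.span T"
    using algebraic_int_powers_rat_span[of x] algebraic_int_powers_rat_span[of "cnj x"] assms by auto
  have "inverse x = cnj x" using assms(2)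
    by (metis complex_div_cnj complex_cnj_one div_by_1 inverse_eq_divide mult_1 of_real_1 one_power2)
  then have "x powi k \<in> rat_vs.span (S \<union> T)" for k
    using S(2)[of "nat k"] T(2)[of "nat (- k)"] rat_vs.span_mono[of S "S \<union> T"] rat_vs.span_mono[of T "S \<union> T"]
    by (auto simp: power_int_def)
  then show ?thesis using S T by blast
qed

lemma unit_algebraic_int_products_rat_span:
  assumes "\<forall>x\<in>set xs. algebraic_int x \<and> cmod x = 1"
  shows "\<exists>S. finite S \<and> (\<forall>k. (\<Prod>i<length xs. xs ! i powi k i) \<in> rat_vs.span S)"
  using assms
proof (induction xs rule: rev_induct)
  case Nil
  show ?case by (intro exI[of _ "{1}"]) (simp add: rat_vs.span_base)
next
  case (snoc x xs)
  then obtain S T where S: "finite S" "\<And>k. (\<Prod>i<length xs. xs ! i powi k i) \<in> rat_vs.span S"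
    and T: "finite T" "\<And>k. x powi k \<in> rat_vs.span T"
    using unit_algebraic_int_powi_rat_span[of x] by auto
  have prod_snoc: "(\<Prod>i<length (xs @ [x]). (xs @ [x]) ! i powi k i) =
      (\<Prod>i<length xs. xs ! i powi k i) * x powi k (length xs)" for k
    by (simp add: nth_append)
  have "(\<Prod>i<length (xs @ [x]). (xs @ [x]) ! i powi k i)
      \<in> rat_vs.span ((\<lambda>(u, v). u * v) ` (S \<times> T))" for k
    unfolding prod_snoc by (rule rat_span_mult[OF S(2) T(2)])
  moreover have "finite ((\<lambda>(u, v). u * v) ` (S \<times> T))" using S(1) T(1) by simp
  ultimately show ?case by (intro exI conjI allI)
qed

text \<open>The \<open>card S + 1\<close> powers \<open>w ^ 0, ..., w ^ card S\<close> lie in a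
  space of dimension at most \<open>card S\<close>; a linear relation among them is the polynomial
  sought.\<close>

lemma rpoly_annihilator_of_finite_span:
  assumes S: "finite S" and w: "\<And>k::nat. w ^ k \<in> rat_vs.span S"
  shows "\<exists>P. P \<noteq> 0 \<and> degree P \<le> card S \<and> rpoly P w = 0"
\<comment> \<open>Dependence is a property of sets, so coinciding powers would be lost in
  \<open>W\<close>. Such a coincidence directly gives the annihilator
  \<open>X^i - X^j\<close>.\<close>
proof (cases "inj_on (\<lambda>i. w ^ i) {..card S}")
  case False
  then obtain i j where ij: "i \<le> card S" "j \<le> card S" "i \<noteq> j" "w ^ i = w ^ j"
    by (auto simp: inj_on_def)
  define P :: "rat poly" where "P = monom 1 i - monom 1 j"
  have "coeff P i = 1" using ij by (simp add: P_def)
  moreover have "degree P \<le> card S" unfolding P_def using ij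
    by (intro degree_diff_le) (auto simp: degree_monom_eq)
  moreover have "map_poly of_rat P = (monom 1 i - monom 1 j :: complex poly)"
    by (rule poly_eqI) (simp add: P_def coeff_map_poly of_rat_diff)
  ultimately show ?thesis using ij by (intro exI[of _ P]) (auto simp: poly_monom)
next
  case True
  define W where "W = (\<lambda>i. w ^ i) ` {..card S}"
  have cardW: "card W = Suc (card S)" and finW: "finite W" using True by (simp_all add: W_def card_image)
  have "rat_vs.dependent W"
  proof (rule ccontr)
    assume "\<not> rat_vs.dependent W"
    then have "card W \<le> card S"
      using rat_vs.independent_span_bound[OF S, of W] w by (auto simp: W_def)
    then show False using cardW by simp
  qed
  then obtain u v where u: "v \<in> W" "u v \<noteq> 0" "(\<Sum>v\<in>W. of_rat (u v) * v) = 0"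
    using finW by (auto simp: rat_vs.dependent_finite)
  define P where "P = (\<Sum>i\<le>card S. monom (u (w ^ i)) i)"
  have coeff: "coeff P i = (if i \<le> card S then u (w ^ i) else 0)" for i
    unfolding P_def by (simp add: coeff_sum)
  have deg: "degree P \<le> card S" by (rule degree_le) (simp add: coeff)
  have "rpoly P w = (\<Sum>i\<le>card S. coeff (map_poly of_rat P) i * w ^ i)"
    by (rule poly_as_sum_of_monoms' [THEN arg_cong, of _ _ "\<lambda>p. poly p w", symmetric, THEN trans])
      (use deg in \<open>simp_all add: poly_sum poly_monom degree_map_poly\<close>)
  also have "\<dots> = (\<Sum>i\<le>card S. of_rat (u (w ^ i)) * w ^ i)"
    by (intro sum.cong) (simp_all add: coeff_map_poly coeff)
  also have "\<dots> = 0" using u(3) True by (simp add: W_def sum.reindex)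
  finally have "rpoly P w = 0" .
  moreover obtain i where "i \<le> card S" "v = w ^ i" using u(1) by (auto simp: W_def)
  then have "coeff P i \<noteq> 0" using u(2) by (simp add: coeff)
  ultimately show ?thesis using deg by (intro exI[of _ P]) auto
qed

subsection \<open>Extending independent sequences\<close>

text \<open>The length is left free, so that terms can be added one at a time, starting even from
  the empty list.\<close>

definition unit_independent :: "complex list \<Rightarrow> bool" where
  "unit_independent xs \<longleftrightarrow>
     (\<forall>x\<in>set xs. algebraic_int x \<and> cmod x = 1) \<and> multiplicatively_independent xs"

lemma unit_independent_Nil: "unit_independent []"
  by (simp add: unit_independent_def multiplicatively_independent_def)

lemma unit_independent_butlast:
  assumes "unit_independent (xs @ [x])"
  shows "unit_independent xs"
  unfolding unit_independent_def multiplicatively_independent_def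
proof (intro conjI allI impI)
  show "\<forall>x\<in>set xs. algebraic_int x \<and> cmod x = 1" using assms by (simp add: unit_independent_def)
next
  fix k :: "nat \<Rightarrow> int" and i
  assume 1: "(\<Prod>i<length xs. xs ! i powi k i) = 1" and i: "i < length xs"
  \<comment> \<open>The given relation says nothing about \<open>k\<close> at index
    \<open>length xs\<close>, so the exponent of the last term has to be set to 0.\<close>
  define k' where "k' = k(length xs := 0)"
  have "(\<Prod>i<length (xs @ [x]). (xs @ [x]) ! i powi k' i) = (\<Prod>i<length xs. xs ! i powi k i)"
    by (simp add: nth_append k'_def)
  then have "k' i = 0" using assms 1 i
    by (simp add: unit_independent_def multiplicatively_independent_def)
  then show "k i = 0" using i by (simp add: k'_def)
qed

text \<open>If a relation involved \<open>z\<close> with exponent \<open>k \<noteq> 0\<close>, all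
  powers of \<open>z ^ \<bar>k\<bar>\<close> would be products of powers of the \<open>xs\<close>
  and so lie in the span of \<open>S\<close>. Then \<open>z ^ \<bar>k\<bar>\<close> would be a root
  of a nonzero rational polynomial of degree at most \<open>card S\<close>, against the choice of
  \<open>z\<close>.\<close>

lemma unit_independent_extend:
  assumes "unit_independent xs"
  shows "\<exists>z. unit_independent (xs @ [z])"
proof -
  have units: "\<forall>x\<in>set xs. algebraic_int x \<and> cmod x = 1"
    and indep: "multiplicatively_independent xs"
    using assms by (auto simp: unit_independent_def)
  obtain S where S: "finite S" "\<forall>k. (\<Prod>i<length xs. xs ! i powi k i) \<in> rat_vs.span S"
    using unit_algebraic_int_products_rat_span[OF units] by (elim exE conjE)
  obtain z where z: "algebraic_int z" "norm z = 1"
    and no: "\<forall>k>0. \<forall>P. P \<noteq> 0 \<longrightarrow> degree P \<le> card S \<longrightarrow> rpoly P (z ^ k) \<noteq> 0"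
    using exists_unit_no_power_of_small_degree[of "card S"] by (elim exE conjE)
  have "k = 0" if k: "(\<Prod>i<length xs. xs ! i powi l i) * z powi k = 1" for l k
  proof (rule ccontr)
    assume "k \<noteq> 0"
    \<comment> \<open>The sign turns a possibly negative \<open>k\<close> into the positive exponent
      \<open>e\<close>, since \<open>z\<close> is controlled only for natural exponents.\<close>
    define \<epsilon> where "\<epsilon> = sgn k"
    define e where "e = nat \<bar>k\<bar>"
    have e: "e > 0" using \<open>k \<noteq> 0\<close> by (simp add: e_def)
    have ke: "k * \<epsilon> = int e" by (simp add: e_def \<epsilon>_def abs_sgn[symmetric])
    have "z powi k = inverse (\<Prod>i<length xs. xs ! i powi l i)"
      using k by (metis inverse_unique mult.commute)
    also have "\<dots> = (\<Prod>i<length xs. xs ! i powi (- l i))"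
      by (simp add: power_int_minus prod_inversef[symmetric])
    finally have zk: "z powi k = (\<Prod>i<length xs. xs ! i powi (- l i))" .
    have prod_powi: "(\<Prod>i\<in>I. f i) powi c = (\<Prod>i\<in>I. f i powi c)" if "finite I"
      for f :: "nat \<Rightarrow> complex" and c I
      using that by (induction) (simp_all add: power_int_mult_distrib)
    have "(z ^ e) ^ j \<in> rat_vs.span S" for j
    proof -
      have "(z ^ e) ^ j = z powi (k * (\<epsilon> * int j))"
        by (metis ke mult.assoc of_nat_mult power_int_of_nat power_mult)
      also have "\<dots> = (\<Prod>i<length xs. xs ! i powi (- l i * (\<epsilon> * int j)))"
        unfolding power_int_mult[of z] zk by (subst prod_powi) (simp_all only: finite_lessThan power_int_mult)
      also have "\<dots> \<in> rat_vs.span S" by (rule S(2)[rule_format])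
      finally show ?thesis .
    qed
    from rpoly_annihilator_of_finite_span[OF S(1) this] no e show False by blast
  qed
  note k0 = this
  have "multiplicatively_independent (xs @ [z])"
    unfolding multiplicatively_independent_def
  proof (intro allI impI)
    fix k :: "nat \<Rightarrow> int" and i
    assume "(\<Prod>i<length (xs @ [z]). (xs @ [z]) ! i powi k i) = 1" and i: "i < length (xs @ [z])"
    then have 1: "(\<Prod>i<length xs. xs ! i powi k i) * z powi k (length xs) = 1"
      by (simp add: nth_append)
    then have k: "k (length xs) = 0" by (rule k0)
    then have "\<forall>i<length xs. k i = 0"
      using 1 indep by (simp add: multiplicatively_independent_def)
    then show "k i = 0" using k i by (auto simp: less_Suc_eq)
  qed
  then show ?thesis using units z by (auto simp: unit_independent_def)
qed

text \<open>
  The case of odd \<open>n\<close> needs the extension lemma: there, \<open>MAU\<close> asks for one more independent term.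
\<close>
lemma MAU_iff: "MAU n xs \<longleftrightarrow> n > 0 \<and> length xs = n \<and> unit_independent xs"
proof (cases "even n")
  case True
  then obtain m where m: "n = 2 * m" by blast
  have "2 * m \<noteq> 2 * l - 1" if "l > 0" for l using that by presburger
  then show ?thesis using m
    by (auto simp: MAU_def MAU_even_def unit_independent_def)
next
  case False
  then obtain m where "n = 2 * m + 1" by (blast elim: oddE)
  then have m: "n = 2 * Suc m - 1" and odd: "\<And>l. n \<noteq> 2 * l" by presburger+
  have uniq: "l = Suc m" if "l > 0" "n = 2 * l - 1" for l using that m by presburger
  have "MAU n xs \<longleftrightarrow> (\<exists>b. MAU_even (Suc m) (xs @ [b]))"
    unfolding MAU_def using odd uniq m by blast
  also have "\<dots> \<longleftrightarrow> length xs = n \<and> (\<exists>b. unit_independent (xs @ [b]))"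
    using m by (auto simp: MAU_even_def unit_independent_def)
  also have "\<dots> \<longleftrightarrow> n > 0 \<and> length xs = n \<and> unit_independent xs"
    using m unit_independent_butlast unit_independent_extend by auto
  finally show ?thesis .
qed

text \<open>Iterate the one-term extension by choice and read off the limit of the growing lists.
  Prefixes shorter than \<open>xs\<close> are reached by dropping last terms.\<close>

lemma unit_independent_sequence:
  assumes "unit_independent xs"
  shows "\<exists>s :: nat \<Rightarrow> complex. map s [0..<length xs] = xs \<and> (\<forall>n. unit_independent (map s [0..<n]))"
proof -
  define F where "F ys = (SOME z. unit_independent (ys @ [z]))" for ys
  have F: "unit_independent (ys @ [F ys])" if "unit_independent ys" for ys
    unfolding F_def using unit_independent_extend[OF that] by (rule someI_ex)
  define L where "L = rec_nat xs (\<lambda>_ ys. ys @ [F ys])"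
  have L0: "L 0 = xs" and LSuc: "\<And>n. L (Suc n) = L n @ [F (L n)]"
    by (simp_all add: L_def)
  have len: "length (L n) = length xs + n" for n by (induction n) (simp_all add: L0 LSuc)
  have indep: "unit_independent (L n)" for n
    by (induction n) (simp_all add: L0 LSuc assms F)
  \<comment> \<open>\<open>L (Suc i)\<close> is the first list sure to have an entry at index
    \<open>i\<close>, even for empty \<open>xs\<close>; later lists never change that entry.\<close>
  define s where "s i = L (Suc i) ! i" for i
  have nth: "L n ! i = s i" if "i < length (L n)" for n i
  proof -
    have stable: "L (a + d) ! i = L a ! i" if "i < length (L a)" for a d
      using that by (induction d) (auto simp: LSuc nth_append len)
    have "i < length (L (Suc i))" by (simp add: len)
    then show ?thesis using stable[of n "Suc i"] stable[of "Suc i" n] that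
      by (simp add: s_def add.commute)
  qed
  have map_s: "map s [0..<length xs + n] = L n" for n
    by (rule nth_equalityI) (simp_all add: len nth)
  have "unit_independent (map s [0..<n])" for n
  proof -
    have prefix: "unit_independent (map s [0..<a])" if "unit_independent (map s [0..<a + d])" for a d
      using that by (induction d) (auto dest: unit_independent_butlast)
    have "unit_independent (map s [0..<n + length xs])"
      using indep[of n] map_s[of n] by (simp add: add.commute)
    then show ?thesis by (rule prefix)
  qed
  moreover have "map s [0..<length xs] = xs" using map_s[of 0] by (simp add: L0)
  ultimately show ?thesis by blast
qed

theorem theorem4p2:
  fixes m :: nat
  assumes "m > 0"
  shows "(\<forall>xs. MAU (2 * m) xs \<longrightarrow> (\<exists>a b. MAU (2 * (m + 1)) (xs @ [a, b]))) \<and>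
         (\<forall>xs. MAU (2 * m) xs \<longrightarrow>
            (\<exists>s :: nat \<Rightarrow> complex. map s [0..<2 * m] = xs \<and> (\<forall>n>0. MAU n (map s [0..<n])))) \<and>
         (\<exists>s :: nat \<Rightarrow> complex. \<forall>n>0. MAU n (map s [0..<n]))"
proof (intro conjI allI impI)
  fix xs assume xs: "MAU (2 * m) xs"
  then obtain a where "unit_independent (xs @ [a])"
    using unit_independent_extend by (auto simp: MAU_iff)
  then obtain b where "unit_independent ((xs @ [a]) @ [b])"
    using unit_independent_extend by blast
  then show "\<exists>a b. MAU (2 * (m + 1)) (xs @ [a, b])"
    using xs by (intro exI[of _ a] exI[of _ b]) (simp add: MAU_iff)
next
  fix xs assume xs: "MAU (2 * m) xs"
  then show "\<exists>s. map s [0..<2 * m] = xs \<and> (\<forall>n>0. MAU n (map s [0..<n]))"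
    using unit_independent_sequence[of xs] by (fastforce simp: MAU_iff)
next
  \<comment> \<open>Starting from the empty list gives an actual sequence, without an MAU supplied
    in advance.\<close>
  show "\<exists>s. \<forall>n>0. MAU n (map s [0..<n])"
    using unit_independent_sequence[OF unit_independent_Nil] by (auto simp: MAU_iff)
qed

end
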